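(* Let $t\geqslant1$, $1\leqslant n\leqslant t$, and let $a_0,\dots,a_t$ be independent variables. Then \[ \sum_{s=0}^t(-1)^s\operatorname{Tr}\Bigl(\Bigl(\frac{\partial}{\partial a_0}D_s(a_0,\dots,a_t)\Bigr)\bigl(D_s(a_0,\dots,a_t)\bigr)^{n-1}\Bigr)=\sum_{s=0}^t(-1)^s\operatorname{Tr}\Bigl(\Bigl(\frac{\partial}{\partial a_n}D_s(a_0,\dots,a_t)\Bigr)\bigl(D_s(a_0,\dots,a_t)\bigr)^{n-1}\Bigr). \]
   Context: $Q_{r,t}$ is the set of strictly increasing sequences $(i_1<\dots<i_r)$ of elements of $\{1,\dots,t\}$ ($Q_{0,t}=\{()\}$). The square matrix $D_r(a_0,\dots,a_t)$ is indexed by $Q_{r,t}$, $0\le r\le t$: $D_0=a_0$ ($1\times1$). For $1\le r\le t$ and $\overline\alpha=(i_1,\dots,i_r)$: if $i_r<t$, the entry $(\overline\alpha,\overline\beta)$ is $a_0$ if $\overline\beta=(i_1+1,\dots,i_r+1)$; is $(-1)^j a_{i_j}$ if $\overline\beta=(1,i_1+1,\dots,\widehat{i_j+1},\dots,i_r+1)$ (the term $i_j+1$ omitted), $1\le j\le r$; and $0$ otherwise. If $i_r=t$, the entry is $(-1)^ra_t$ if $\overline\beta=(1,i_1+1,\dots,i_{r-1}+1)$ and $0$ otherwise. Derivatives are entrywise. *)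

theory Defs
  imports "HOL-Library.Poly_Mapping" "Jordan_Normal_Form.Matrix"
begin

section \<open>Polynomials in the independent variables \<open>a\<^sub>0, a\<^sub>1, \<dots>\<close>\<close>

text \<open>A monomial is a finitely supported exponent vector \<open>m\<close>, and a polynomial is a finitely
  supported family of coefficients indexed by monomials. The library's product on
  \<^typ>\<open>(nat \<Rightarrow>\<^sub>0 nat) \<Rightarrow>\<^sub>0 'k\<close> is then the usual product of polynomials.\<close>

type_synonym 'k mpoly = "(nat \<Rightarrow>\<^sub>0 nat) \<Rightarrow>\<^sub>0 'k"

definition var :: "nat \<Rightarrow> 'k::comm_ring_1 mpoly" where
  "var i = Poly_Mapping.single (Poly_Mapping.single i 1) 1"

text \<open>Termwise partial derivative. The truncated subtraction on exponents is harmless: a term whose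
  exponent at \<open>i\<close> is \<open>0\<close> gets the coefficient \<open>0\<close>.\<close>

definition partial_deriv :: "nat \<Rightarrow> 'k::comm_ring_1 mpoly \<Rightarrow> 'k mpoly" where
  "partial_deriv i p =
     (\<Sum>m\<in>Poly_Mapping.keys p.
        Poly_Mapping.single (m - Poly_Mapping.single i 1)
          (of_nat (Poly_Mapping.lookup m i) * Poly_Mapping.lookup p m))"

lemma partial_deriv_single:
  "partial_deriv i (Poly_Mapping.single m c) =
     Poly_Mapping.single (m - Poly_Mapping.single i 1) (of_nat (Poly_Mapping.lookup m i) * c)"
  by (cases "c = 0") (simp_all add: partial_deriv_def)

lemma partial_deriv_var:
  "partial_deriv i (var j :: 'k::comm_ring_1 mpoly) = (if i = j then 1 else 0)"
  by (auto simp: var_def partial_deriv_single lookup_single when_def)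

lemma partial_deriv_add: "partial_deriv i (p + q) = partial_deriv i p + partial_deriv i q"
proof -
  let ?f = "\<lambda>p m. Poly_Mapping.single (m - Poly_Mapping.single i 1)
          (of_nat (Poly_Mapping.lookup m i) * Poly_Mapping.lookup p m)"
  let ?A = "Poly_Mapping.keys p \<union> Poly_Mapping.keys q \<union> Poly_Mapping.keys (p + q)"
  have *: "partial_deriv i r = (\<Sum>m\<in>?A. ?f r m)" if "Poly_Mapping.keys r \<subseteq> ?A" for r
    unfolding partial_deriv_def
    by (rule sum.mono_neutral_left) (use that in \<open>auto simp: in_keys_iff\<close>)
  have "partial_deriv i (p + q) = (\<Sum>m\<in>?A. ?f (p + q) m)"
    by (rule *) blast
  also have "\<dots> = (\<Sum>m\<in>?A. ?f p m + ?f q m)"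
    by (simp only: lookup_add distrib_left single_add)
  also have "\<dots> = (\<Sum>m\<in>?A. ?f p m) + (\<Sum>m\<in>?A. ?f q m)"
    by (rule sum.distrib)
  also have "\<dots> = partial_deriv i p + partial_deriv i q"
    by (intro arg_cong2[where f = "(+)"] *[symmetric]) blast+
  finally show ?thesis .
qed

section \<open>The matrices \<open>D\<^sub>r(a\<^sub>0, \<dots>, a\<^sub>t)\<close>\<close>

text \<open>\<open>Q r t\<close> lists the strictly increasing sequences of length \<open>r\<close> in \<open>{1..t}\<close>. The order of the
  listing is the numbering of rows and columns; another order conjugates all matrices by a
  permutation matrix and does not affect traces of products.\<close>

definition Q :: "nat \<Rightarrow> nat \<Rightarrow> nat list list" where
  "Q r t = filter (\<lambda>\<alpha>. length \<alpha> = r) (subseqs [1..<Suc t])"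

lemma set_subseqs_strict_sorted:
  fixes xs :: "'a::linorder list"
  assumes "sorted_wrt (<) xs"
  shows "set (subseqs xs) = {ys. sorted_wrt (<) ys \<and> set ys \<subseteq> set xs}"
proof -
  have sub: "set ys \<subseteq> set xs" if "ys \<in> set (subseqs xs)" for ys xs :: "'a list"
    using that subseqs_powset[of xs] by (metis PowD imageI)
  have sorted: "sorted_wrt (<) ys"
    if "sorted_wrt (<) xs" "ys \<in> set (subseqs xs)" for ys xs :: "'a list"
    using that
  proof (induction xs arbitrary: ys)
    case (Cons x xs)
    have xs: "sorted_wrt (<) xs" "\<forall>z\<in>set xs. x < z" using Cons.prems(1) by simp_all
    from Cons.prems(2) consider "ys \<in> set (subseqs xs)"
      | zs where "ys = x # zs" "zs \<in> set (subseqs xs)"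
      by (auto simp: Let_def)
    then show ?case
    proof cases
      case 1
      then show ?thesis using Cons.IH xs(1) by blast
    next
      case 2
      then have "sorted_wrt (<) zs" "set zs \<subseteq> set xs" using Cons.IH xs(1) sub by blast+
      then show ?thesis using 2(1) xs(2) by auto
    qed
  qed simp
  have "ys \<in> set (subseqs xs)" if ys: "sorted_wrt (<) ys" "set ys \<subseteq> set xs" for ys
  proof -
    obtain zs where zs: "zs \<in> set (subseqs xs)" "set zs = set ys"
      using subset_subseqs[OF ys(2)] by auto
    have "sorted_wrt (<) zs" using sorted[OF assms zs(1)] .
    then have "zs = ys" using strict_sorted_equal ys(1) zs(2) by blast
    with zs show ?thesis by simp
  qed
  with sub sorted[OF assms] show ?thesis by blast
qed

lemma set_Q: "set (Q r t) = {\<alpha>. length \<alpha> = r \<and> sorted_wrt (<) \<alpha> \<and> set \<alpha> \<subseteq> {1..t}}"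
proof -
  have "set (subseqs [1..<Suc t]) = {\<alpha>. sorted_wrt (<) \<alpha> \<and> set \<alpha> \<subseteq> set [1..<Suc t]}"
    by (rule set_subseqs_strict_sorted) (simp only: strict_sorted_iff sorted_upt distinct_upt)
  then show ?thesis by (auto simp: Q_def)
qed

lemma distinct_Q: "distinct (Q r t)"
proof -
  have "distinct (map set (subseqs [1..<Suc t]))" by (rule distinct_set_subseqs) simp
  then show ?thesis unfolding Q_def by (simp only: distinct_map distinct_filter)
qed

text \<open>\<open>\<alpha> ! (j - 1)\<close> is the \<open>j\<close>-th element \<open>i\<^sub>j\<close>, and \<open>omit j \<alpha>\<close> drops it.\<close>

definition omit :: "nat \<Rightarrow> 'a list \<Rightarrow> 'a list" where
  "omit j \<alpha> = take (j - 1) \<alpha> @ drop j \<alpha>"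

text \<open>In the middle branch at most one summand has its column condition satisfied, since the
  elements of \<open>\<alpha>\<close> are distinct; see the lemmas below.\<close>

definition D_entry :: "nat \<Rightarrow> (nat \<Rightarrow> 'a::comm_ring_1) \<Rightarrow> nat list \<Rightarrow> nat list \<Rightarrow> 'a" where
  "D_entry t a \<alpha> \<beta> =
     (if \<alpha> = [] then a 0
      else if last \<alpha> < t then
        (if \<beta> = map Suc \<alpha> then a 0
         else \<Sum>j = 1..length \<alpha>.
                if \<beta> = 1 # map Suc (omit j \<alpha>) then (-1) ^ j * a (\<alpha> ! (j - 1)) else 0)
      else
        (if \<beta> = 1 # map Suc (butlast \<alpha>) then (-1) ^ length \<alpha> * a t else 0))"

lemma omit_inj:
  assumes "distinct \<alpha>" "j \<in> {1..length \<alpha>}" "k \<in> {1..length \<alpha>}" "omit j \<alpha> = omit k \<alpha>"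
  shows "j = k"
proof -
  have *: "set (omit j \<alpha>) = set \<alpha> - {\<alpha> ! (j - 1)}" if "j \<in> {1..length \<alpha>}" for j
  proof -
    define xs y ys where "xs = take (j - 1) \<alpha>" and "y = \<alpha> ! (j - 1)" and "ys = drop j \<alpha>"
    have "Suc (j - 1) = j" "j - 1 < length \<alpha>" using that by auto
    then have \<alpha>: "\<alpha> = xs @ y # ys"
      using id_take_nth_drop[of "j - 1" \<alpha>] unfolding xs_def y_def ys_def by metis
    with \<open>distinct \<alpha>\<close> have "y \<notin> set xs \<union> set ys" by auto
    then have "set xs \<union> set ys = insert y (set xs \<union> set ys) - {y}" by blast
    also have "\<dots> = set \<alpha> - {y}" by (subst \<alpha>) auto
    finally show ?thesis by (simp add: omit_def xs_def y_def ys_def)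
  qed
  have "\<alpha> ! (j - 1) \<in> set \<alpha>" "\<alpha> ! (k - 1) \<in> set \<alpha>" using assms by auto
  moreover have "set \<alpha> - {\<alpha> ! (j - 1)} = set \<alpha> - {\<alpha> ! (k - 1)}"
    using *[OF assms(2)] *[OF assms(3)] assms(4) by simp
  ultimately have "\<alpha> ! (j - 1) = \<alpha> ! (k - 1)" by blast
  moreover have "j - 1 < length \<alpha>" "k - 1 < length \<alpha>" using assms(2,3) by auto
  ultimately have "j - 1 = k - 1" using nth_eq_iff_index_eq[OF assms(1)] by blast
  with assms(2,3) show ?thesis by auto
qed

lemma D_entry_shift:
  "last \<alpha> < t \<Longrightarrow> D_entry t a \<alpha> (map Suc \<alpha>) = a 0"
  by (simp add: D_entry_def)

lemma D_entry_omit: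
  assumes "sorted_wrt (<) \<alpha>" "set \<alpha> \<subseteq> {1..t}" "last \<alpha> < t" "j \<in> {1..length \<alpha>}"
  shows "D_entry t a \<alpha> (1 # map Suc (omit j \<alpha>)) = (-1) ^ j * a (\<alpha> ! (j - 1))"
proof -
  have "distinct \<alpha>" using assms(1) strict_sorted_iff by blast
  have ne: "1 # map Suc (omit j \<alpha>) \<noteq> map Suc \<alpha>"
    using assms(2) by (cases \<alpha>) auto
  have eq: "omit j \<alpha> = omit k \<alpha> \<longleftrightarrow> j = k" if "k \<in> {1..length \<alpha>}" for k
    using omit_inj[OF \<open>distinct \<alpha>\<close> assms(4) that] by auto
  have "(\<Sum>k = 1..length \<alpha>. if 1 # map Suc (omit j \<alpha>) = 1 # map Suc (omit k \<alpha>)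
            then (-1) ^ k * a (\<alpha> ! (k - 1)) else 0) =
        (\<Sum>k = 1..length \<alpha>. if j = k then (-1) ^ k * a (\<alpha> ! (k - 1)) else 0)"
    by (rule sum.cong[OF refl]) (simp add: eq inj_map_eq_map)
  also have "\<dots> = (-1) ^ j * a (\<alpha> ! (j - 1))"
    by (subst sum.delta') (use assms(4) in auto)
  finally show ?thesis
    using assms(3,4) ne unfolding D_entry_def by (auto simp del: list.inject)
qed

lemma D_entry_zero:
  assumes "\<alpha> \<noteq> []" "last \<alpha> < t" "\<beta> \<noteq> map Suc \<alpha>"
    and "\<And>j. j \<in> {1..length \<alpha>} \<Longrightarrow> \<beta> \<noteq> 1 # map Suc (omit j \<alpha>)"
  shows "D_entry t a \<alpha> \<beta> = 0"
  using assms by (auto simp: D_entry_def intro!: sum.neutral)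

definition D_mat :: "nat \<Rightarrow> nat \<Rightarrow> (nat \<Rightarrow> 'a::comm_ring_1) \<Rightarrow> 'a mat" where
  "D_mat t r a =
     mat (length (Q r t)) (length (Q r t)) (\<lambda>(k, l). D_entry t a (Q r t ! k) (Q r t ! l))"

text \<open>Only meant for square matrices.\<close>

definition mat_trace :: "'a::comm_monoid_add mat \<Rightarrow> 'a" where
  "mat_trace A = (\<Sum>i<dim_row A. A $$ (i, i))"

end

theory Submission
  imports Defs
begin

text \<open>Encode a row index by the set \<open>A\<close> of its elements. Then \<open>D\<^sub>s\<close> is a transfer matrix: every
  nonzero entry is a step that adjoins \<open>0\<close> to \<open>A\<close>, removes some \<open>k\<close> and shifts the result by one,
  with weight \<open>\<plusminus>a\<^sub>k\<close>. The two sides of the theorem are signed sums over closed walks of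
  length \<open>n\<close> whose first step removes \<open>0\<close>, respectively \<open>n\<close>. If
  \<open>A\<^sub>0 \<rightarrow> A\<^sub>1 \<rightarrow> \<dots> \<rightarrow> A\<^sub>n = A\<^sub>0\<close> is a walk of the first kind, then \<open>i \<notin> A\<^sub>i\<close> for \<open>1 \<le> i \<le> n\<close>, and
  replacing \<open>A\<^sub>i\<close> by \<open>A\<^sub>i \<union> {i}\<close> gives a walk of the second kind. This is a bijection: an
  element \<open>i + 1\<close> of a state can only come from an element \<open>i\<close> of the preceding one. The bijection
  preserves all weights after the first step up to signs, and these telescope.\<close>

text \<open>There is no case distinction on \<open>max A = t\<close>: if \<open>t \<in> A\<close> and \<open>k \<noteq> t\<close>, the target contains
  \<open>t + 1\<close> and is excluded by summing over subsets of \<open>{1..t}\<close> only.\<close>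

definition step :: "nat \<Rightarrow> nat set \<Rightarrow> nat set \<Rightarrow> 'a::comm_ring_1" where
  "step k A B =
     (if k \<in> insert 0 A \<and> B = Suc ` (insert 0 A - {k}) then (-1) ^ card {y \<in> A. y \<le> k} else 0)"

definition weight :: "(nat \<Rightarrow> 'a::comm_ring_1) \<Rightarrow> nat set \<Rightarrow> nat set \<Rightarrow> 'a" where
  "weight a A B = (\<Sum>k\<in>insert 0 A. a k * step k A B)"

text \<open>Intermediate states range over subsets of every size, so one function serves all
  \<open>D_mat t r a\<close> at once; steps between subsets of \<open>{1..t}\<close> preserve the
  size. The last step is split off because \<open>^\<^sub>m\<close> multiplies the new factor on the
  right.\<close>

primrec walk :: "nat \<Rightarrow> (nat \<Rightarrow> 'a::comm_ring_1) \<Rightarrow> nat \<Rightarrow> nat set \<Rightarrow> nat set \<Rightarrow> 'a" where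
  "walk t a 0 A B = (if A = B then 1 else 0)"
| "walk t a (Suc m) A B = (\<Sum>C\<in>Pow {1..t}. walk t a m A C * weight a C B)"

text \<open>This is the potential whose values at the two ends of a step give the sign change when
  \<open>i\<close> joins the source and \<open>Suc i\<close> the target. Along a walk its inner
  values occur twice and cancel.\<close>

definition sgn_above :: "nat \<Rightarrow> nat set \<Rightarrow> 'a::comm_ring_1" where
  "sgn_above i A = (-1) ^ card {y \<in> A. i < y}"

section \<open>Signs and weights of single steps\<close>

lemma sgn_above_mult_self: "sgn_above i A * sgn_above i A = 1"
  by (simp add: sgn_above_def flip: power_mult_distrib)

lemma step_0:
  assumes "0 \<notin> A"
  shows "step 0 A B = (if B = Suc ` A then 1 else 0)"
proof -
  have *: "insert 0 A - {0} = A" "{y \<in> A. y \<le> 0} = {}" using assms by auto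
  show ?thesis unfolding step_def * by simp
qed

lemma step_eq_0_if_notin:
  assumes "1 \<le> i" "i \<notin> A" "Suc i \<in> B"
  shows "step k A B = 0"
  using assms by (auto simp: step_def)

lemma weight_eq_0_if_notin:
  assumes "1 \<le> i" "i \<notin> A" "Suc i \<in> B"
  shows "weight a A B = 0"
  by (simp add: weight_def step_eq_0_if_notin[OF assms])

text \<open>Adjoining 0 and removing \<open>k\<close> balance out and the shift is injective. This
  later allows sums over subsets of one size to be extended to all subsets.\<close>

lemma step_eq_0_if_card_neq:
  assumes "finite A" "0 \<notin> A" "card A \<noteq> card B"
  shows "step k A B = 0"
proof (rule ccontr)
  assume "step k A B \<noteq> 0"
  then have k: "k \<in> insert 0 A" and B: "B = Suc ` (insert 0 A - {k})"
    by (auto simp: step_def split: if_splits)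
  have "card B = card (insert 0 A - {k})"
    unfolding B by (rule card_image) simp
  also have "\<dots> = card A"
    using assms k by (subst card_Diff_singleton) auto
  finally show False using assms by simp
qed

lemma weight_eq_0_if_card_neq:
  assumes "finite A" "0 \<notin> A" "card A \<noteq> card B"
  shows "weight a A B = 0"
  by (simp add: weight_def step_eq_0_if_card_neq[OF assms])

text \<open>The exponent counting the elements up to \<open>k\<close> grows by one exactly if
  \<open>i < k\<close>. On the other side, the elements of B above \<open>Suc i\<close> are the
  shifts of those of A above \<open>i\<close> other than \<open>k\<close>, so the two values of
  \<open>sgn_above\<close> differ in sign exactly if \<open>i < k\<close> as well.\<close>

lemma step_insert:
  assumes "finite A" "1 \<le> i" "i \<notin> A" "Suc i \<notin> B" "0 \<notin> A" "k \<noteq> i"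
  shows "step k (insert i A) (insert (Suc i) B) = sgn_above i A * sgn_above (Suc i) B * step k A B"
proof (cases "k \<in> insert 0 A")
  case k: True
  let ?R = "insert 0 A - {k}"
  have img: "insert 0 (insert i A) - {k} = insert i ?R" using \<open>k \<noteq> i\<close> by auto
  have "Suc i \<notin> Suc ` ?R" using assms by auto
  then have iff: "insert (Suc i) B = Suc ` insert i ?R \<longleftrightarrow> B = Suc ` ?R"
    using assms(4) by (simp add: insert_ident)
  show ?thesis
  proof (cases "B = Suc ` ?R")
    case B: True
    have "{y \<in> B. Suc i < y} = Suc ` {y \<in> A - {k}. i < y}"
      unfolding B by auto
    then have cB: "card {y \<in> B. Suc i < y} = card {y \<in> A - {k}. i < y}"
      by (simp add: card_image)
    have cA: "card {y \<in> A. i < y} = card {y \<in> A - {k}. i < y} + (if i < k then 1 else 0)"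
    proof (cases "i < k")
      case True
      then have "{y \<in> A. i < y} = insert k {y \<in> A - {k}. i < y}" using k by auto
      then show ?thesis using True \<open>finite A\<close> by simp
    next
      case False
      then have "{y \<in> A. i < y} = {y \<in> A - {k}. i < y}" by auto
      then show ?thesis using False by simp
    qed
    have cI: "card {y \<in> insert i A. y \<le> k} = card {y \<in> A. y \<le> k} + (if i < k then 1 else 0)"
    proof (cases "i < k")
      case True
      then have "{y \<in> insert i A. y \<le> k} = insert i {y \<in> A. y \<le> k}" by auto
      then show ?thesis using True assms by simp
    next
      case False
      then have "{y \<in> insert i A. y \<le> k} = {y \<in> A. y \<le> k}" using \<open>k \<noteq> i\<close> by auto
      then show ?thesis using False by simp
    qed
    have sq: "(-1 :: 'a) ^ c * (-1) ^ c = 1" for c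
      by (simp flip: power_mult_distrib)
    have "sgn_above i A * sgn_above (Suc i) B = (if i < k then -1 else 1 :: 'a)"
      unfolding sgn_above_def cB cA using sq[of "card {y \<in> A - {k}. i < y}"] by simp
    moreover have "step k A B = ((-1) ^ card {y \<in> A. y \<le> k} :: 'a)"
      using k B by (simp add: step_def)
    moreover have "step k (insert i A) (insert (Suc i) B) = ((-1) ^ card {y \<in> insert i A. y \<le> k} :: 'a)"
      using k iff B by (simp only: step_def img) auto
    ultimately show ?thesis unfolding cI by simp
  next
    case False
    then show ?thesis using iff by (simp only: step_def img) simp
  qed
next
  case False
  then show ?thesis using \<open>k \<noteq> i\<close> by (simp add: step_def)
qed

lemma weight_insert:
  assumes "finite A" "1 \<le> i" "i \<notin> A" "Suc i \<notin> B" "0 \<notin> A"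
  shows "weight a (insert i A) (insert (Suc i) B) =
           sgn_above i A * sgn_above (Suc i) B * weight a A B"
proof -
  \<comment> \<open>Removing \<open>i\<close> before the shift would keep \<open>Suc i\<close> out
    of the target.\<close>
  have "step i (insert i A) (insert (Suc i) B) = (0 :: 'a)"
    by (auto simp: step_def)
  then have "weight a (insert i A) (insert (Suc i) B) =
      (\<Sum>k\<in>insert 0 A. a k * step k (insert i A) (insert (Suc i) B))"
    unfolding weight_def using assms by (intro sum.mono_neutral_right) auto
  also have "\<dots> = (\<Sum>k\<in>insert 0 A. a k * (sgn_above i A * sgn_above (Suc i) B * step k A B))"
    using assms by (intro sum.cong refl, subst step_insert) auto
  also have "\<dots> = sgn_above i A * sgn_above (Suc i) B * weight a A B"
    by (simp only: weight_def sum_distrib_left mult.left_commute)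
  finally show ?thesis .
qed

section \<open>Adjoining an element to every state of a walk\<close>

text \<open>Traced backwards, \<open>i + m\<close> must come from \<open>i + m - 1\<close> and so on
  down to \<open>i\<close>. The adjoined 0 only produces the element 1, which never interferes
  because \<open>1 \<le> i\<close>.\<close>

lemma walk_eq_0_if_notin:
  assumes "1 \<le> i" "i \<notin> A" "i + m \<in> B"
  shows "walk t a m A B = 0"
  using assms(3)
proof (induction m arbitrary: B)
  case 0
  then show ?case using assms by auto
next
  case (Suc m)
  have "walk t a m A C * weight a C B = 0" for C
  proof (cases "i + m \<in> C")
    case False
    then show ?thesis using weight_eq_0_if_notin[of "i + m" C B a] assms Suc.prems by simp
  qed (simp add: Suc.IH)
  then show ?case by simp
qed

lemma sum_Pow_insert:
  assumes "i \<in> S" "finite S" and "\<And>C. i \<notin> C \<Longrightarrow> f C = 0"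
  shows "(\<Sum>C\<in>Pow S. f C) = (\<Sum>C\<in>Pow (S - {i}). f (insert i C))"
proof -
  have inj: "inj_on (insert i) (Pow (S - {i}))"
    by (auto simp: inj_on_def)
  have "(\<Sum>C\<in>Pow S. f C) = (\<Sum>C\<in>insert i ` Pow (S - {i}). f C)"
  proof (rule sum.mono_neutral_right)
    show "\<forall>C\<in>Pow S - insert i ` Pow (S - {i}). f C = 0"
    proof
      fix C assume C: "C \<in> Pow S - insert i ` Pow (S - {i})"
      have "i \<notin> C"
      proof
        assume "i \<in> C"
        then have "C = insert i (C - {i})" by auto
        moreover have "C - {i} \<in> Pow (S - {i})" using C by auto
        ultimately show False using C by blast
      qed
      then show "f C = 0" by (rule assms(3))
    qed
  qed (use assms in auto)
  also have "\<dots> = (\<Sum>C\<in>Pow (S - {i}). f (insert i C))"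
    by (simp add: sum.reindex[OF inj])
  finally show ?thesis .
qed

lemma sum_Pow_remove:
  assumes "finite S" and "\<And>C. i \<in> C \<Longrightarrow> f C = 0"
  shows "(\<Sum>C\<in>Pow S. f C) = (\<Sum>C\<in>Pow (S - {i}). f C)"
  using assms by (intro sum.mono_neutral_right) auto

text \<open>Adjoining \<open>i\<close>, \<open>i + 1\<close>, ..., \<open>i + m\<close> to the
  successive states matches the walks on both sides: those not of this form contribute 0. By
  \<open>weight_insert\<close> the signs telescope to the two ends. The bound
  \<open>i + m \<le> t\<close> keeps the enlarged intermediate states inside
  \<open>{1..t}\<close>.\<close>

lemma walk_insert:
  assumes "1 \<le> i" "i \<notin> A" "i + m \<le> t" "i + m \<notin> B"
  shows "walk t a m (insert i A) (insert (i + m) B) =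
           sgn_above i A * sgn_above (i + m) B * walk t a m A B"
  using assms(3,4)
proof (induction m arbitrary: B)
  case 0
  then have "insert i A = insert i B \<longleftrightarrow> A = B"
    using assms by (simp add: insert_ident)
  then show ?case by (auto simp: sgn_above_mult_self)
next
  case (Suc m)
  let ?j = "i + m"
  have "walk t a (Suc m) (insert i A) (insert (i + Suc m) B) =
      (\<Sum>C\<in>Pow {1..t}. walk t a m (insert i A) C * weight a C (insert (Suc ?j) B))"
    by simp
  \<comment> \<open>A state without \<open>?j\<close> cannot step to one containing
    \<open>Suc ?j\<close>, so only states of the form \<open>insert ?j C\<close> remain.\<close>
  also have "\<dots> = (\<Sum>C\<in>Pow ({1..t} - {?j}).
      walk t a m (insert i A) (insert ?j C) * weight a (insert ?j C) (insert (Suc ?j) B))"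
    using Suc.prems assms
    by (intro sum_Pow_insert) (auto simp: weight_eq_0_if_notin[of ?j])
  also have "\<dots> = (\<Sum>C\<in>Pow ({1..t} - {?j}).
      sgn_above i A * sgn_above (Suc ?j) B * (walk t a m A C * weight a C B))"
  proof (rule sum.cong[OF refl])
    fix C assume C: "C \<in> Pow ({1..t} - {?j})"
    have "finite C" using C finite_subset[of C "{1..t} - {?j}"] by auto
    then have W: "weight a (insert ?j C) (insert (Suc ?j) B) =
        sgn_above ?j C * sgn_above (Suc ?j) B * weight a C B"
      using C Suc.prems assms(1) by (intro weight_insert) auto
    have "walk t a m (insert i A) (insert ?j C) =
        sgn_above i A * sgn_above ?j C * walk t a m A C"
      using C Suc.prems by (intro Suc.IH) auto
    then have "walk t a m (insert i A) (insert ?j C) * weight a (insert ?j C) (insert (Suc ?j) B) =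
        (sgn_above ?j C * sgn_above ?j C) *
        (sgn_above i A * sgn_above (Suc ?j) B * (walk t a m A C * weight a C B))"
      unfolding W by (simp only: mult_ac)
    then show "walk t a m (insert i A) (insert ?j C) * weight a (insert ?j C) (insert (Suc ?j) B) =
        sgn_above i A * sgn_above (Suc ?j) B * (walk t a m A C * weight a C B)"
      by (simp only: sgn_above_mult_self mult_1_left)
  qed
  also have "\<dots> = sgn_above i A * sgn_above (Suc ?j) B *
      (\<Sum>C\<in>Pow ({1..t} - {?j}). walk t a m A C * weight a C B)"
    by (simp only: sum_distrib_left)
  \<comment> \<open>Conversely, a state containing \<open>?j\<close> is unreachable from A, since
    \<open>i \<notin> A\<close>; restoring such states to the sum adds only zeros.\<close>
  also have "(\<Sum>C\<in>Pow ({1..t} - {?j}). walk t a m A C * weight a C B) = walk t a (Suc m) A B"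
    unfolding walk.simps
    by (intro sum_Pow_remove[symmetric]) (auto simp: walk_eq_0_if_notin[OF assms(1,2)])
  finally show ?case by simp
qed

section \<open>The identity for signed sums of closed walks\<close>

text \<open>The summand of A on the left equals that of \<open>insert n A\<close> on the right. Both
  first steps are forced, and their targets differ only by the element 1. The other steps are
  compared by \<open>walk_insert\<close> with \<open>i = 1\<close> and \<open>m = n - 1\<close>,
  which adjoins exactly \<open>n\<close> to the final state.\<close>

lemma sum_closed_walks:
  assumes "1 \<le> n" "n \<le> t"
  shows "(\<Sum>A\<in>Pow {1..t}. (-1) ^ card A *
            (\<Sum>B\<in>Pow {1..t}. step 0 A B * walk t a (n - 1) B A)) =
         (\<Sum>A\<in>Pow {1..t}. (-1) ^ card A *
            (\<Sum>B\<in>Pow {1..t}. step n A B * walk t a (n - 1) B A))"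
    (is "sum ?f _ = sum ?g _")
proof -
  have S: "n \<in> {1..t}" using assms by simp
  have f: "?f A = (if Suc ` A \<subseteq> {1..t} then (-1) ^ card A * walk t a (n - 1) (Suc ` A) A else 0)"
    if "0 \<notin> A" for A
  proof -
    show ?thesis by (simp add: step_0[OF that] if_distrib[where f = "\<lambda>x. x * _"] cong: if_cong)
  qed
  \<comment> \<open>Returning to a state that contains \<open>n\<close> after \<open>n - 1\<close>
    further steps requires 1 after the first step, hence 0 in A.\<close>
  have f0: "?f A = 0" if "n \<in> A" "0 \<notin> A" for A
  proof -
    have "1 \<notin> Suc ` A" using that by auto
    then have "walk t a (n - 1) (Suc ` A) A = 0"
      using that assms by (intro walk_eq_0_if_notin) auto
    then show ?thesis unfolding f[OF that(2)] by simp
  qed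
  have g0: "?g A = 0" if "n \<notin> A" for A
    using that assms by (auto simp: step_def)
  have g: "?g (insert n A) = ?f A" if "A \<in> Pow ({1..t} - {n})" for A
  proof -
    have fin: "finite A" and A: "n \<notin> A" "0 \<notin> A"
      using that finite_subset[of A "{1..t} - {n}"] by auto
    \<comment> \<open>The adjoined 0 survives when \<open>n\<close> is removed, and the shift turns
      it into the element 1.\<close>
    have ins: "insert 0 (insert n A) - {n} = insert 0 A" using A assms by auto
    have "{y \<in> insert n A. y \<le> n} = insert n {y \<in> A. y \<le> n}" by auto
    then have "card {y \<in> insert n A. y \<le> n} = Suc (card {y \<in> A. y \<le> n})"
      using fin A by simp
    then have "step n (insert n A) B =
        (if B = insert 1 (Suc ` A) then - ((-1) ^ card {y \<in> A. y \<le> n}) else 0 :: 'a)" for B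
      by (simp add: step_def ins del: One_nat_def) simp
    then have "?g (insert n A) = (if insert 1 (Suc ` A) \<subseteq> {1..t}
        then (-1) ^ card (insert n A) * (- ((-1) ^ card {y \<in> A. y \<le> n}) *
          walk t a (n - 1) (insert 1 (Suc ` A)) (insert n A)) else 0)"
      by (simp add: if_distrib[where f = "\<lambda>x. x * _"] del: One_nat_def cong: if_cong)
    moreover have "insert 1 (Suc ` A) \<subseteq> {1..t} \<longleftrightarrow> Suc ` A \<subseteq> {1..t}"
      using assms by simp
    \<comment> \<open>The minus signs from \<open>card (insert n A)\<close> and from the first step
      cancel. All elements of the shifted A exceed 1, so \<open>sgn_above 1\<close> gives
      \<open>(-1) ^ card A\<close>; the elements of A up to \<open>n\<close> and above
      \<open>n\<close> together give another such factor. With the outer sign this makes three, that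
      is, one.\<close>
    moreover have "(-1) ^ card (insert n A) * (- ((-1) ^ card {y \<in> A. y \<le> n}) *
          walk t a (n - 1) (insert 1 (Suc ` A)) (insert n A)) =
        (-1) ^ card A * walk t a (n - 1) (Suc ` A) A"
    proof -
      have W: "walk t a (n - 1) (insert 1 (Suc ` A)) (insert n A) =
          sgn_above 1 (Suc ` A) * sgn_above n A * walk t a (n - 1) (Suc ` A) A"
        using walk_insert[of 1 "Suc ` A" "n - 1" t A a] A assms by auto
      have "{y \<in> Suc ` A. 1 < y} = Suc ` A" using A by (auto intro: gr0I)
      then have s1: "sgn_above 1 (Suc ` A) = ((-1) ^ card A :: 'a)"
        by (simp only: sgn_above_def) (simp add: card_image)
      have "card A = card ({y \<in> A. y \<le> n} \<union> {y \<in> A. n < y})"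
        by (rule arg_cong[where f = card]) auto
      also have "\<dots> = card {y \<in> A. y \<le> n} + card {y \<in> A. n < y}"
        using fin by (intro card_Un_disjoint) auto
      finally have s2: "(-1) ^ card {y \<in> A. y \<le> n} * sgn_above n A = ((-1) ^ card A :: 'a)"
        by (simp only: sgn_above_def power_add)
      have s3: "(-1) ^ card (insert n A) = - ((-1) ^ card A :: 'a)"
        using fin A by simp
      have "(-1) ^ card (insert n A) * (- ((-1) ^ card {y \<in> A. y \<le> n}) *
            walk t a (n - 1) (insert 1 (Suc ` A)) (insert n A)) =
          ((-1) ^ card A * (-1) ^ card A) *
          (((-1) ^ card {y \<in> A. y \<le> n} * sgn_above n A) * walk t a (n - 1) (Suc ` A) A)"
        unfolding W s1 s3
        by (simp only: mult_minus_left mult_minus_right minus_minus mult_ac)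
      also have "(-1) ^ card A * (-1) ^ card A = (1 :: 'a)"
        by (simp flip: power_mult_distrib)
      finally show ?thesis unfolding s2 by simp
    qed
    ultimately show ?thesis unfolding f[OF A(2)] by (simp only:)
  qed
  have "sum ?f (Pow {1..t}) = sum ?f (Pow ({1..t} - {n}))"
  proof (rule sum.mono_neutral_right)
    show "\<forall>A\<in>Pow {1..t} - Pow ({1..t} - {n}). ?f A = 0"
    proof
      fix A assume "A \<in> Pow {1..t} - Pow ({1..t} - {n})"
      then have "n \<in> A" "0 \<notin> A" by auto
      then show "?f A = 0" by (rule f0)
    qed
  qed auto
  also have "\<dots> = (\<Sum>A\<in>Pow ({1..t} - {n}). ?g (insert n A))"
    by (rule sum.cong[OF refl], rule g[symmetric])
  also have "\<dots> = sum ?g (Pow {1..t})"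
    by (rule sum_Pow_insert[symmetric, OF S]) (use g0 in auto)
  finally show ?thesis .
qed

section \<open>Matrix entries as weights of steps\<close>

lemma set_omit:
  assumes "distinct \<alpha>" "j \<in> {1..length \<alpha>}"
  shows "set (omit j \<alpha>) = set \<alpha> - {\<alpha> ! (j - 1)}"
proof -
  define xs y ys where "xs = take (j - 1) \<alpha>" and "y = \<alpha> ! (j - 1)" and "ys = drop j \<alpha>"
  have "Suc (j - 1) = j" "j - 1 < length \<alpha>" using assms(2) by auto
  then have \<alpha>: "\<alpha> = xs @ y # ys"
    using id_take_nth_drop[of "j - 1" \<alpha>] unfolding xs_def y_def ys_def by metis
  with \<open>distinct \<alpha>\<close> have "y \<notin> set xs \<union> set ys" by auto
  then have "set xs \<union> set ys = set \<alpha> - {y}" by (subst \<alpha>) auto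
  then show ?thesis by (simp add: omit_def xs_def y_def ys_def)
qed

lemma sorted_wrt_omit: "sorted_wrt R \<alpha> \<Longrightarrow> sorted_wrt R (omit j \<alpha>)"
proof -
  assume "sorted_wrt R \<alpha>"
  then have *: "sorted_wrt R (take (j - 1) \<alpha> @ drop (j - 1) \<alpha>)" by simp
  have "set (drop j \<alpha>) \<subseteq> set (drop (j - 1) \<alpha>)" by (rule set_drop_subset_set_drop) simp
  then show ?thesis
    using * \<open>sorted_wrt R \<alpha>\<close> unfolding omit_def sorted_wrt_append
    by (auto intro: sorted_wrt_drop)
qed

text \<open>Identifies the exponent \<open>j\<close> in the matrix entry with the cardinality in the
  sign of \<open>step\<close>.\<close>

lemma card_le_nth_strict_sorted:
  fixes \<alpha> :: "'a::linorder list"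
  assumes "sorted_wrt (<) \<alpha>" "j \<in> {1..length \<alpha>}"
  shows "card {y \<in> set \<alpha>. y \<le> \<alpha> ! (j - 1)} = j"
proof -
  have j: "j - 1 < length \<alpha>" using assms(2) by auto
  have dist: "distinct \<alpha>" using assms(1) strict_sorted_iff by blast
  have "\<alpha> ! i \<le> \<alpha> ! (j - 1) \<longleftrightarrow> i < j" if "i < length \<alpha>" for i
    using sorted_wrt_nth_less[OF assms(1), of i "j - 1"] sorted_wrt_nth_less[OF assms(1), of "j - 1" i]
      that j assms(2) by (cases i "j - 1" rule: linorder_cases) auto
  then have "{y \<in> set \<alpha>. y \<le> \<alpha> ! (j - 1)} = (!) \<alpha> ` {..<j}"
    using assms(2) by (fastforce simp: set_conv_nth)
  moreover have "inj_on ((!) \<alpha>) {..<j}"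
    using dist assms(2) by (auto intro!: inj_onI simp: nth_eq_iff_index_eq)
  ultimately show ?thesis by (simp add: card_image)
qed

text \<open>Removes the case distinction on the last element. If it is \<open>t\<close>, a column
  inside \<open>{1..t}\<close> rules out the shift of the whole row and every omission that keeps
  \<open>t\<close>; the omission of \<open>t\<close> itself is the entry prescribed in that
  case.\<close>

lemma D_entry_eq_sum:
  assumes "\<alpha> \<in> set (Q r t)" "\<beta> \<in> set (Q r t)"
  shows "D_entry t a \<alpha> \<beta> = (if \<beta> = map Suc \<alpha> then a 0 else 0) +
    (\<Sum>j = 1..length \<alpha>.
       if \<beta> = 1 # map Suc (omit j \<alpha>) then (-1) ^ j * a (\<alpha> ! (j - 1)) else 0)"
proof (cases "\<alpha> = []")
  case True
  \<comment> \<open>Here \<open>r = 0\<close>, so the column is empty too and equals the shifted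
    row.\<close>
  then show ?thesis using assms by (simp add: set_Q D_entry_def)
next
  case ne: False
  have \<alpha>: "sorted_wrt (<) \<alpha>" "set \<alpha> \<subseteq> {1..t}" and \<beta>: "set \<beta> \<subseteq> {1..t}"
    using assms by (auto simp: set_Q)
  have dist: "distinct \<alpha>" using \<alpha>(1) strict_sorted_iff by blast
  show ?thesis
  proof (cases "last \<alpha> < t")
    case True
    \<comment> \<open>Shifted entries are at least 2, so the two column conditions exclude each
      other and the nested conditional becomes a sum.\<close>
    have "map Suc \<alpha> \<noteq> 1 # map Suc (omit j \<alpha>)" for j
      using \<alpha>(2) by (cases \<alpha>) auto
    then show ?thesis using ne True by (auto simp: D_entry_def)
  next
    case False
    have "last \<alpha> \<in> set \<alpha>" using ne by simp
    then have t: "last \<alpha> = t" using \<alpha>(2) False by fastforce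
    let ?n = "length \<alpha>"
    have n: "?n \<in> {1..?n}" using ne by (cases \<alpha>) auto
    have "Suc t \<in> set (map Suc \<alpha>)" "Suc t \<notin> set \<beta>" using \<open>last \<alpha> \<in> set \<alpha>\<close> t \<beta> by auto
    then have "\<beta> \<noteq> map Suc \<alpha>" by metis
    moreover have "\<beta> \<noteq> 1 # map Suc (omit j \<alpha>)" if "j \<in> {1..?n} - {?n}" for j
    proof
      assume *: "\<beta> = 1 # map Suc (omit j \<alpha>)"
      have "\<alpha> ! (j - 1) \<noteq> t"
        using that n dist ne t by (auto simp: last_conv_nth nth_eq_iff_index_eq)
      then have "t \<in> set (omit j \<alpha>)"
        using set_omit[OF dist, of j] that \<open>last \<alpha> \<in> set \<alpha>\<close> t by auto
      then show False using * \<beta> by auto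
    qed
    then have "(\<Sum>j = 1..?n.
         if \<beta> = 1 # map Suc (omit j \<alpha>) then (-1) ^ j * a (\<alpha> ! (j - 1)) else 0) =
       (if \<beta> = 1 # map Suc (omit ?n \<alpha>) then (-1) ^ ?n * a (\<alpha> ! (?n - 1)) else 0)"
      by (subst sum.remove[OF _ n]) (auto intro!: sum.neutral)
    moreover have "omit ?n \<alpha> = butlast \<alpha>" by (simp add: omit_def butlast_conv_take)
    ultimately show ?thesis using ne t by (simp add: D_entry_def last_conv_nth)
  qed
qed

text \<open>Strictly increasing lists are determined by their sets, so the column conditions become
  the set equations in \<open>step\<close>. The shift is the term of \<open>k = 0\<close>, the
  omission of the \<open>j\<close>-th element that of \<open>k = \<alpha> ! (j - 1)\<close>.\<close>

lemma D_entry_eq_weight: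
  assumes "\<alpha> \<in> set (Q r t)" "\<beta> \<in> set (Q r t)"
  shows "D_entry t a \<alpha> \<beta> = weight a (set \<alpha>) (set \<beta>)"
proof -
  have \<alpha>: "sorted_wrt (<) \<alpha>" "0 \<notin> set \<alpha>" and \<beta>: "sorted_wrt (<) \<beta>"
    using assms by (auto simp: set_Q)
  have dist: "distinct \<alpha>" using \<alpha>(1) strict_sorted_iff by blast
  have eq: "\<beta> = \<gamma> \<longleftrightarrow> set \<beta> = set \<gamma>" if "sorted_wrt (<) \<gamma>" for \<gamma>
    using strict_sorted_equal \<beta> that by blast
  have "sorted_wrt (<) (map Suc \<alpha>)" using \<alpha> by (simp add: sorted_wrt_map)
  then have "(if \<beta> = map Suc \<alpha> then a 0 else 0) = a 0 * step 0 (set \<alpha>) (set \<beta>)"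
    using \<alpha>(2) by (simp add: step_0 eq)
  moreover have "(\<Sum>j = 1..length \<alpha>.
       if \<beta> = 1 # map Suc (omit j \<alpha>) then (-1) ^ j * a (\<alpha> ! (j - 1)) else 0) =
     (\<Sum>k\<in>set \<alpha>. a k * step k (set \<alpha>) (set \<beta>))"
  proof -
    let ?h = "\<lambda>j. \<alpha> ! (j - 1)"
    have "(\<Sum>j = 1..length \<alpha>.
         if \<beta> = 1 # map Suc (omit j \<alpha>) then (-1) ^ j * a (?h j) else 0) =
       (\<Sum>j = 1..length \<alpha>. a (?h j) * step (?h j) (set \<alpha>) (set \<beta>))"
    proof (rule sum.cong[OF refl])
      fix j assume j: "j \<in> {1..length \<alpha>}"
      then have h: "?h j \<in> set \<alpha>" by auto
      have "\<forall>x \<in> set (omit j \<alpha>). 1 < Suc x"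
        using set_omit[OF dist j] \<alpha>(2) by (auto intro: gr0I)
      then have "sorted_wrt (<) (1 # map Suc (omit j \<alpha>))"
        using sorted_wrt_omit[OF \<alpha>(1), of j] by (simp add: sorted_wrt_map)
      moreover have "Suc ` (insert 0 (set \<alpha>) - {?h j}) = set (1 # map Suc (omit j \<alpha>))"
        using set_omit[OF dist j] h \<alpha>(2) by auto
      ultimately show "(if \<beta> = 1 # map Suc (omit j \<alpha>) then (-1) ^ j * a (?h j) else 0) =
          a (?h j) * step (?h j) (set \<alpha>) (set \<beta>)"
        using card_le_nth_strict_sorted[OF \<alpha>(1) j] h by (simp only: eq) (simp add: step_def)
    qed
    also have "\<dots> = (\<Sum>k\<in>set \<alpha>. a k * step k (set \<alpha>) (set \<beta>))"
    proof (rule sum.reindex_bij_betw)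
      have "bij_betw (\<lambda>j. j - 1) {1..length \<alpha>} {..<length \<alpha>}"
        by (rule bij_betw_byWitness[where f' = Suc]) auto
      then show "bij_betw ?h {1..length \<alpha>} (set \<alpha>)"
        using bij_betw_trans[OF _ bij_betw_nth[OF dist refl refl]] by (simp add: comp_def)
    qed
    finally show ?thesis .
  qed
  ultimately show ?thesis
    unfolding D_entry_eq_sum[OF assms] weight_def using \<alpha> by simp
qed

section \<open>From sums over matrix indices to sums over subsets\<close>

lemma sum_Q: "(\<Sum>k<length (Q r t). f (set (Q r t ! k))) = (\<Sum>A | A \<subseteq> {1..t} \<and> card A = r. f A)"
proof (rule sum.reindex_bij_betw)
  have "bij_betw set (set (Q r t)) {A. A \<subseteq> {1..t} \<and> card A = r}"
  proof (rule bij_betw_byWitness[where f' = sorted_list_of_set])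
    show "\<forall>\<alpha>\<in>set (Q r t). sorted_list_of_set (set \<alpha>) = \<alpha>"
      by (auto simp: set_Q strict_sorted_iff sorted_list_of_set.idem_if_sorted_distinct)
    show "\<forall>A\<in>{A. A \<subseteq> {1..t} \<and> card A = r}. set (sorted_list_of_set A) = A"
      using finite_subset[of _ "{1..t}"] by auto
    show "set ` set (Q r t) \<subseteq> {A. A \<subseteq> {1..t} \<and> card A = r}"
      by (auto simp: set_Q strict_sorted_iff distinct_card)
    show "sorted_list_of_set ` {A. A \<subseteq> {1..t} \<and> card A = r} \<subseteq> set (Q r t)"
    proof
      fix \<alpha> assume "\<alpha> \<in> sorted_list_of_set ` {A. A \<subseteq> {1..t} \<and> card A = r}"
      then obtain A where A: "\<alpha> = sorted_list_of_set A" "A \<subseteq> {1..t}" "card A = r" by auto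
      have "finite A" using A(2) by (rule finite_subset) simp
      then show "\<alpha> \<in> set (Q r t)" using A by (simp add: set_Q)
    qed
  qed
  then show "bij_betw (\<lambda>k. set (Q r t ! k)) {..<length (Q r t)} {A. A \<subseteq> {1..t} \<and> card A = r}"
    using bij_betw_trans[OF bij_betw_nth[OF distinct_Q refl refl]] by (simp add: comp_def)
qed

lemma sum_Q_Pow:
  assumes "\<And>A. A \<subseteq> {1..t} \<Longrightarrow> card A \<noteq> r \<Longrightarrow> f A = 0"
  shows "(\<Sum>k<length (Q r t). f (set (Q r t ! k))) = (\<Sum>A\<in>Pow {1..t}. f A)"
  unfolding sum_Q by (rule sum.mono_neutral_left) (use assms in auto)

lemma set_nth_Q:
  assumes "k < length (Q r t)"
  shows "set (Q r t ! k) \<subseteq> {1..t}" "card (set (Q r t ! k)) = r"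
  using nth_mem[OF assms] by (auto simp: set_Q strict_sorted_iff distinct_card)

lemma D_mat_power:
  "D_mat t r a ^\<^sub>m m = mat (length (Q r t)) (length (Q r t))
     (\<lambda>(k, l). walk t a m (set (Q r t ! k)) (set (Q r t ! l)))"
proof (induction m)
  case 0
  have "set (Q r t ! k) = set (Q r t ! l) \<longleftrightarrow> k = l"
    if "k < length (Q r t)" "l < length (Q r t)" for k l
  proof -
    have "sorted_wrt (<) (Q r t ! k)" "sorted_wrt (<) (Q r t ! l)"
      using that[THEN nth_mem] by (simp_all add: set_Q)
    then have "set (Q r t ! k) = set (Q r t ! l) \<longleftrightarrow> Q r t ! k = Q r t ! l"
      by (metis strict_sorted_equal)
    then show ?thesis using that by (simp add: nth_eq_iff_index_eq[OF distinct_Q])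
  qed
  then show ?case by (intro eq_matI) (auto simp: D_mat_def)
next
  case (Suc m)
  let ?N = "length (Q r t)" and ?S = "\<lambda>k. set (Q r t ! k)"
  show ?case
  proof (rule eq_matI)
    fix k l assume "k < dim_row (mat ?N ?N (\<lambda>(k, l). walk t a (Suc m) (?S k) (?S l)))"
      "l < dim_col (mat ?N ?N (\<lambda>(k, l). walk t a (Suc m) (?S k) (?S l)))"
    then have k: "k < ?N" and l: "l < ?N" by simp_all
    have "(D_mat t r a ^\<^sub>m Suc m) $$ (k, l) =
        (\<Sum>i<?N. walk t a m (?S k) (?S i) * D_entry t a (Q r t ! i) (Q r t ! l))"
      using k l by (simp add: Suc) (simp add: D_mat_def scalar_prod_def atLeast0LessThan)
    also have "\<dots> = (\<Sum>i<?N. walk t a m (?S k) (?S i) * weight a (?S i) (?S l))"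
      using l by (intro sum.cong refl) (simp add: D_entry_eq_weight[of _ r])
    also have "\<dots> = (\<Sum>C\<in>Pow {1..t}. walk t a m (?S k) C * weight a C (?S l))"
    proof (rule sum_Q_Pow)
      fix C assume C: "C \<subseteq> {1..t}" "card C \<noteq> r"
      have "weight a C (?S l) = 0"
        using C set_nth_Q[OF l] finite_subset[OF C(1)] by (intro weight_eq_0_if_card_neq) auto
      then show "walk t a m (?S k) C * weight a C (?S l) = 0" by simp
    qed
    finally show "(D_mat t r a ^\<^sub>m Suc m) $$ (k, l) =
        mat ?N ?N (\<lambda>(k, l). walk t a (Suc m) (?S k) (?S l)) $$ (k, l)"
      using k l by simp
  qed (simp_all add: Suc D_mat_def)
qed

section \<open>Partial derivatives and traces\<close>

lemma partial_deriv_0: "partial_deriv i 0 = 0"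
  by (simp add: partial_deriv_def)

lemma partial_deriv_uminus: "partial_deriv i (- p) = - partial_deriv i p"
  using partial_deriv_add[of i p "- p"] by (simp add: partial_deriv_0 eq_neg_iff_add_eq_0 add.commute)

lemma partial_deriv_sum: "partial_deriv i (\<Sum>x\<in>X. f x) = (\<Sum>x\<in>X. partial_deriv i (f x))"
  by (induction X rule: infinite_finite_induct) (simp_all add: partial_deriv_0 partial_deriv_add)

text \<open>The weight is linear in the variables with coefficients 0, 1 or -1, so additivity and
  change of sign give the derivative.\<close>

lemma partial_deriv_weight:
  assumes "finite A"
  shows "partial_deriv i (weight var A B :: 'a::comm_ring_1 mpoly) = step i A B"
proof -
  have *: "partial_deriv i (var k * step k A B :: 'a mpoly) =
      (if i = k then step k A B else 0)" for k
    by (cases "even (card {y \<in> A. y \<le> k})")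
      (auto simp: step_def partial_deriv_var partial_deriv_uminus partial_deriv_0)
  have "partial_deriv i (weight var A B :: 'a mpoly) =
      (\<Sum>k\<in>insert 0 A. if i = k then step k A B else 0)"
    unfolding weight_def partial_deriv_sum * ..
  also have "\<dots> = (if i \<in> insert 0 A then step i A B else 0)"
    using assms by (subst sum.delta') auto
  \<comment> \<open>For \<open>i\<close> outside \<open>insert 0 A\<close> both sides are 0 by the
    first condition in \<open>step\<close>.\<close>
  also have "\<dots> = step i A B" by (simp add: step_def)
  finally show ?thesis .
qed

text \<open>The differentiated factor is the distinguished first step, and the trace closes the
  walk. Only the inner sum is freed from the size condition; the outer one keeps it, since the sign
  in the alternating sum depends on the size.\<close>

lemma mat_trace_deriv_power:
  "mat_trace (map_mat (partial_deriv i) (D_mat t r (var :: nat \<Rightarrow> 'a::comm_ring_1 mpoly)) *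
      D_mat t r var ^\<^sub>m m) =
     (\<Sum>A | A \<subseteq> {1..t} \<and> card A = r. \<Sum>B\<in>Pow {1..t}. step i A B * walk t var m B A)"
proof -
  let ?N = "length (Q r t)" and ?S = "\<lambda>k. set (Q r t ! k)"
  have "mat_trace (map_mat (partial_deriv i) (D_mat t r (var :: nat \<Rightarrow> 'a mpoly)) *
       D_mat t r var ^\<^sub>m m) =
      (\<Sum>k<?N. \<Sum>l<?N. partial_deriv i (D_entry t var (Q r t ! k) (Q r t ! l)) *
        walk t var m (?S l) (?S k))"
    by (simp add: mat_trace_def D_mat_power) (simp add: D_mat_def scalar_prod_def atLeast0LessThan)
  also have "\<dots> = (\<Sum>k<?N. \<Sum>l<?N. step i (?S k) (?S l) * walk t var m (?S l) (?S k))"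
    by (intro sum.cong refl) (simp add: D_entry_eq_weight[of _ r] partial_deriv_weight)
  also have "\<dots> = (\<Sum>k<?N. \<Sum>B\<in>Pow {1..t}. step i (?S k) B * walk t var m B (?S k))"
  proof (rule sum.cong[OF refl], rule sum_Q_Pow)
    fix k B assume "k \<in> {..<?N}" "B \<subseteq> {1..t}" "card B \<noteq> r"
    then have "step i (?S k) B = (0 :: 'a mpoly)"
      using set_nth_Q[of k r t] by (intro step_eq_0_if_card_neq) auto
    then show "step i (?S k) B * walk t var m B (?S k) = (0 :: 'a mpoly)" by simp
  qed
  also have "\<dots> = (\<Sum>A | A \<subseteq> {1..t} \<and> card A = r. \<Sum>B\<in>Pow {1..t}. step i A B * walk t var m B A)"
    by (rule sum_Q)
  finally show ?thesis .
qed

text \<open>Grouping the subsets of \<open>{1..t}\<close> by size merges all the traces into one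
  sum.\<close>

lemma alternating_sum_mat_trace:
  "(\<Sum>s = 0..t. (-1) ^ s *
      mat_trace (map_mat (partial_deriv i) (D_mat t s var) * D_mat t s var ^\<^sub>m m)) =
   (\<Sum>A\<in>Pow {1..t}. (-1) ^ card A * (\<Sum>B\<in>Pow {1..t}. step i A B * walk t var m B A))"
proof -
  have "card ` Pow {1..t} \<subseteq> {0..t}"
    using card_mono[of "{1..t}"] by fastforce
  then show ?thesis
    unfolding mat_trace_deriv_power sum_distrib_left
    by (subst sum.group[symmetric, of "Pow {1..t}" "{0..t}" card]) (auto intro!: sum.cong)
qed

theorem theorem28:
  fixes t n :: nat
  assumes "t \<ge> 1" and "1 \<le> n" and "n \<le> t"
  shows "(\<Sum>s = 0..t. (-1) ^ s *
            mat_trace (map_mat (partial_deriv 0) (D_mat t s (var :: nat \<Rightarrow> 'k::comm_ring_1 mpoly))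
                       * D_mat t s var ^\<^sub>m (n - 1)))
       = (\<Sum>s = 0..t. (-1) ^ s *
            mat_trace (map_mat (partial_deriv n) (D_mat t s (var :: nat \<Rightarrow> 'k mpoly))
                       * D_mat t s var ^\<^sub>m (n - 1)))"
  unfolding alternating_sum_mat_trace using assms(2,3) by (rule sum_closed_walks)

end
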